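(* Let $\mathcal{H}$ and $\mathcal{K}$ be infinite-dimensional complex separable Hilbert spaces. Suppose that $T\in B(\mathcal{H})$ has no isolated point in its spectrum and that $S\in B(\mathcal{K})$ satisfies property $(UW_E)$. If $\sigma_{uw}(T\oplus S)=\sigma_a(T)\cup\sigma_{uw}(S)$ and $\sigma_2(T)=\emptyset$, then $T\oplus S$ satisfies property $(UW_E)$.
   Context: For a bounded operator $T$ on a Hilbert space, $\alpha(T)$ is the dimension of the kernel, $\beta(T)$ the codimension of the range, $\sigma(T)$ the spectrum, $\operatorname{iso}\sigma(T)$ the set of isolated points of $\sigma(T)$, and $\sigma_a(T)$ the approximate point spectrum (the set of $\lambda$ such that $T-\lambda I$ is not bounded below). $T$ is semi-Fredholm if its range is closed and $\alpha(T)<\infty$ or $\beta(T)<\infty$; its index is $i(T)=\alpha(T)-\beta(T)$. $T$ is upper semi-Weyl if it is semi-Fredholm with $i(T)\le 0$, and $\sigma_{uw}(T)=\{\lambda\in\mathbb{C}: T-\lambda I\text{ is not upper semi-Weyl}\}$. $E(T)=\{\lambda\in\operatorname{iso}\sigma(T):\alpha(T-\lambda I)>0\}$. $T$ satisfies property $(UW_E)$ if $\sigma_a(T)\setminus E(T)=\sigma_{uw}(T)$, i.e. $\sigma_a(T)\setminus\sigma_{uw}(T)=E(T)$. $\sigma_2(T)=\sigma(T)\setminus\sigma_a(T)$. $T\oplus S$ is the direct sum operator on $\mathcal{H}\oplus\mathcal{K}$, $(T\oplus S)(x\oplus y)=Tx\oplus Sy$. *)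

theory Defs
  imports "HOL-Analysis.Analysis" "HOL-Library.Extended_Nat" "HOL-Library.Extended_Real"
begin

section \<open>Complex Hilbert spaces\<close>

text \<open>The underlying real inner product (and hence the norm) is the real part of the
  complex one, which is linear in its first argument.\<close>

class complex_inner = real_inner +
  fixes scaleC :: "complex \<Rightarrow> 'a \<Rightarrow> 'a"  (infixr \<open>*\<^sub>C\<close> 75)
    and cinner :: "'a \<Rightarrow> 'a \<Rightarrow> complex"
  assumes scaleC_add_right: "a *\<^sub>C (x + y) = a *\<^sub>C x + a *\<^sub>C y"
    and scaleC_add_left: "(a + b) *\<^sub>C x = a *\<^sub>C x + b *\<^sub>C x"
    and scaleC_scaleC: "a *\<^sub>C (b *\<^sub>C x) = (a * b) *\<^sub>C x"
    and scaleC_one: "1 *\<^sub>C x = x"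
    and scaleR_eq_scaleC: "r *\<^sub>R x = complex_of_real r *\<^sub>C x"
    and cinner_commute: "cinner x y = cnj (cinner y x)"
    and cinner_add_left: "cinner (x + y) z = cinner x z + cinner y z"
    and cinner_scaleC_left: "cinner (a *\<^sub>C x) y = a * cinner x y"
    and inner_eq_Re_cinner: "inner x y = Re (cinner x y)"

class complex_hilbert_space = complex_inner + complete_space

global_interpretation cvec: vector_space "scaleC :: complex \<Rightarrow> 'a \<Rightarrow> 'a::complex_inner"
  defines cdependent = cvec.dependent
    and csubspace = cvec.subspace
    and cspan = cvec.span
    and cdim = cvec.dim
  by unfold_locales
     (simp_all add: scaleC_add_right scaleC_add_left scaleC_scaleC scaleC_one)

abbreviation cindependent :: "'a::complex_inner set \<Rightarrow> bool"
  where "cindependent B \<equiv> \<not> cdependent B"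

text \<open>The Hilbert space direct sum is the product type: its norm is already
  \<open>sqrt ((norm x)\<^sup>2 + (norm y)\<^sup>2)\<close>.\<close>

instantiation prod :: (complex_inner, complex_inner) complex_inner
begin

definition scaleC_prod :: "complex \<Rightarrow> 'a \<times> 'b \<Rightarrow> 'a \<times> 'b"
  where "scaleC_prod a p = (a *\<^sub>C fst p, a *\<^sub>C snd p)"

definition cinner_prod :: "'a \<times> 'b \<Rightarrow> 'a \<times> 'b \<Rightarrow> complex"
  where "cinner_prod p q = cinner (fst p) (fst q) + cinner (snd p) (snd q)"

instance
proof
  fix a b :: complex and r :: real and x y z :: "'a \<times> 'b"
  show "cinner x y = cnj (cinner y x)"
    using cinner_commute[of "fst x" "fst y"] cinner_commute[of "snd x" "snd y"]
    by (simp add: cinner_prod_def)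
qed (auto simp: scaleC_prod_def cinner_prod_def scaleC_add_right scaleC_add_left
      scaleC_scaleC scaleC_one scaleR_eq_scaleC cinner_add_left cinner_scaleC_left
      inner_eq_Re_cinner inner_prod_def scaleR_prod_def algebra_simps)

end

instance prod :: (complex_hilbert_space, complex_hilbert_space) complex_hilbert_space ..


section \<open>Dimension and codimension\<close>

text \<open>\<open>cdim\<close> is 0 on infinite-dimensional subspaces, hence the case distinction.\<close>

definition edim :: "'a::complex_inner set \<Rightarrow> enat"
  where "edim V = (if \<exists>B. finite B \<and> V \<subseteq> cspan B then enat (cdim V) else \<infinity>)"

text \<open>The dimension of the quotient by \<open>V\<close>: the supremum of the sizes of finite sets
  that are linearly independent modulo \<open>V\<close>. It agrees with the dimension of any algebraic
  complement of \<open>V\<close>, see \<open>codim_eq_edim_complement\<close> below.\<close>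

definition independent_mod :: "'a::complex_inner set \<Rightarrow> 'a set \<Rightarrow> bool"
  where "independent_mod V B \<longleftrightarrow> (\<forall>a. (\<Sum>b\<in>B. a b *\<^sub>C b) \<in> V \<longrightarrow> (\<forall>b\<in>B. a b = 0))"

definition codim :: "'a::complex_inner set \<Rightarrow> enat"
  where "codim V = Sup {enat (card B) | B. finite B \<and> independent_mod V B}"

lemma independent_mod_complement:
  assumes "csubspace W" "V \<inter> W = {0}" "B \<subseteq> W" "finite B" "cindependent B"
  shows "independent_mod V B"
  unfolding independent_mod_def
proof (intro allI impI)
  fix a assume V: "(\<Sum>b\<in>B. a b *\<^sub>C b) \<in> V"
  have "(\<Sum>b\<in>B. a b *\<^sub>C b) \<in> W"
    using assms by (intro cvec.subspace_sum cvec.subspace_scale) auto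
  then have "(\<Sum>b\<in>B. a b *\<^sub>C b) = 0"
    using V assms(2) by blast
  then show "\<forall>b\<in>B. a b = 0"
    using cvec.independentD[OF assms(5,4) order_refl] by blast
qed

lemma card_independent_mod_le:
  assumes V: "csubspace V" and W: "csubspace W"
    and sum: "\<And>x. \<exists>v\<in>V. \<exists>w\<in>W. x = v + w"
    and B: "finite B" "independent_mod V B"
    and C: "finite C" "W \<subseteq> cspan C"
  shows "card B \<le> card C"
proof -
  have "\<exists>w. w \<in> W \<and> x - w \<in> V" for x
    using sum[of x] by force
  then obtain p where p: "\<And>x. p x \<in> W" "\<And>x. x - p x \<in> V"
    by metis
  have inj: "inj_on p B"
  proof (rule inj_onI, rule ccontr)
    fix b c assume bc: "b \<in> B" "c \<in> B" "p b = p c" "b \<noteq> c"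
    define a where "a = (\<lambda>x. if x = b then 1 else if x = c then -1 else (0::complex))"
    have "(\<Sum>x\<in>B. a x *\<^sub>C x) = (\<Sum>x\<in>{b,c}. a x *\<^sub>C x)"
      using bc B(1) by (intro sum.mono_neutral_right) (auto simp: a_def)
    also have "\<dots> = b - c"
      using bc by (simp add: a_def)
    also have "\<dots> = (b - p b) - (c - p c)"
      using bc by simp
    also have "\<dots> \<in> V"
      by (intro cvec.subspace_diff V p)
    finally have "a b = 0"
      using B(2) bc(1) unfolding independent_mod_def by blast
    then show False by (simp add: a_def)
  qed
  have "cindependent (p ` B)"
  proof (rule cvec.independent_if_scalars_zero)
    show "finite (p ` B)" using B by simp
  next
    fix u x assume u: "(\<Sum>x\<in>p ` B. u x *\<^sub>C x) = 0" and x: "x \<in> p ` B"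
    have 0: "(\<Sum>b\<in>B. u (p b) *\<^sub>C p b) = 0"
      using u inj by (simp add: sum.reindex)
    have "(\<Sum>b\<in>B. u (p b) *\<^sub>C b) = (\<Sum>b\<in>B. u (p b) *\<^sub>C (b - p b))"
      by (simp add: cvec.scale_right_diff_distrib sum_subtractf 0)
    also have "\<dots> \<in> V"
      by (intro cvec.subspace_sum cvec.subspace_scale V p)
    finally have "\<forall>b\<in>B. u (p b) = 0"
      using B(2)[unfolded independent_mod_def, rule_format, of "\<lambda>b. u (p b)"] by simp
    then show "u x = 0"
      using x by blast
  qed
  moreover have "p ` B \<subseteq> cspan C"
    using p C by blast
  ultimately have "card (p ` B) \<le> card C"
    using cvec.independent_span_bound[OF C(1)] by blast
  then show ?thesis
    using inj by (simp add: card_image)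
qed

lemma codim_eq_edim_complement:
  assumes V: "csubspace V" and W: "csubspace W"
    and int: "V \<inter> W = {0}" and sum: "\<And>x. \<exists>v\<in>V. \<exists>w\<in>W. x = v + w"
  shows "codim V = edim W"
proof -
  obtain C where C: "C \<subseteq> W" "cindependent C" "W \<subseteq> cspan C" "card C = cdim W"
    using cvec.basis_exists by blast
  have lower: "enat (card D) \<le> codim V" if "D \<subseteq> C" "finite D" for D
    unfolding codim_def
    using that C independent_mod_complement[OF W int, of D] cvec.independent_mono[of C D]
    by (intro Sup_upper) auto
  show ?thesis
  proof (cases "\<exists>B. finite B \<and> W \<subseteq> cspan B")
    case True
    then have fin: "finite C"
      using C cvec.independent_span_bound by (meson subset_trans)
    have "codim V \<le> enat (card C)"
      unfolding codim_def
      using card_independent_mod_le[OF V W sum _ _ fin C(3)] by (auto intro!: Sup_least)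
    then show ?thesis
      using lower[OF order_refl fin] True C(4) by (simp add: edim_def)
  next
    case False
    then have inf: "infinite C"
      using C(3) by blast
    have le: "enat n \<le> codim V" for n
    proof -
      obtain D where "finite D" "card D = n" "D \<subseteq> C"
        using infinite_arbitrarily_large[OF inf, of n] by blast
      then show ?thesis using lower[of D] by simp
    qed
    have "codim V = \<infinity>"
    proof (cases "codim V")
      case (enat m)
      then show ?thesis using le[of "Suc m"] by simp
    qed
    then show ?thesis
      using False by (simp add: edim_def)
  qed
qed


section \<open>Spectral theory of bounded operators\<close>

definition bounded_clinear :: "('a::complex_inner \<Rightarrow> 'b::complex_inner) \<Rightarrow> bool"
  where "bounded_clinear T \<longleftrightarrow> bounded_linear T \<and> (\<forall>a x. T (a *\<^sub>C x) = a *\<^sub>C T x)"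

definition op_shift :: "('a::complex_inner \<Rightarrow> 'a) \<Rightarrow> complex \<Rightarrow> 'a \<Rightarrow> 'a"
  where "op_shift T z = (\<lambda>x. T x - z *\<^sub>C x)"

definition op_sum :: "('a \<Rightarrow> 'a) \<Rightarrow> ('b \<Rightarrow> 'b) \<Rightarrow> 'a \<times> 'b \<Rightarrow> 'a \<times> 'b"  (infixr \<open>\<oplus>\<^sub>o\<^sub>p\<close> 65)
  where "T \<oplus>\<^sub>o\<^sub>p S = (\<lambda>(x, y). (T x, S y))"

definition nullity :: "('a::complex_inner \<Rightarrow> 'b::complex_inner) \<Rightarrow> enat"
  where "nullity T = edim {x. T x = 0}"

definition deficiency :: "('a::complex_inner \<Rightarrow> 'b::complex_inner) \<Rightarrow> enat"
  where "deficiency T = codim (range T)"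

definition spectrum :: "('a::complex_inner \<Rightarrow> 'a) \<Rightarrow> complex set"
  where "spectrum T =
    {z. \<not> (\<exists>R. bounded_clinear R \<and> R \<circ> op_shift T z = id \<and> op_shift T z \<circ> R = id)}"

definition iso_spectrum :: "('a::complex_inner \<Rightarrow> 'a) \<Rightarrow> complex set"
  where "iso_spectrum T = {z. z isolated_in spectrum T}"

definition bounded_below :: "('a::complex_inner \<Rightarrow> 'b::complex_inner) \<Rightarrow> bool"
  where "bounded_below T \<longleftrightarrow> (\<exists>c>0. \<forall>x. c * norm x \<le> norm (T x))"

definition approx_spectrum :: "('a::complex_inner \<Rightarrow> 'a) \<Rightarrow> complex set"
  where "approx_spectrum T = {z. \<not> bounded_below (op_shift T z)}"

definition sigma2 :: "('a::complex_inner \<Rightarrow> 'a) \<Rightarrow> complex set"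
  where "sigma2 T = spectrum T - approx_spectrum T"

definition semi_Fredholm :: "('a::complex_inner \<Rightarrow> 'b::complex_inner) \<Rightarrow> bool"
  where "semi_Fredholm T \<longleftrightarrow> closed (range T) \<and> (nullity T < \<infinity> \<or> deficiency T < \<infinity>)"

text \<open>The index is meaningful for semi-Fredholm operators only, where the difference is
  never of the form \<open>\<infinity> - \<infinity>\<close>.\<close>

definition index :: "('a::complex_inner \<Rightarrow> 'b::complex_inner) \<Rightarrow> ereal"
  where "index T = ereal_of_enat (nullity T) - ereal_of_enat (deficiency T)"

definition upper_semi_Weyl :: "('a::complex_inner \<Rightarrow> 'b::complex_inner) \<Rightarrow> bool"
  where "upper_semi_Weyl T \<longleftrightarrow> semi_Fredholm T \<and> index T \<le> 0"

definition upper_semi_Weyl_spectrum :: "('a::complex_inner \<Rightarrow> 'a) \<Rightarrow> complex set"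
  where "upper_semi_Weyl_spectrum T = {z. \<not> upper_semi_Weyl (op_shift T z)}"

definition iso_eigenvalues :: "('a::complex_inner \<Rightarrow> 'a) \<Rightarrow> complex set"
  where "iso_eigenvalues T = {z \<in> iso_spectrum T. nullity (op_shift T z) > 0}"

definition property_UWE :: "('a::complex_inner \<Rightarrow> 'a) \<Rightarrow> bool"
  where "property_UWE T \<longleftrightarrow> approx_spectrum T - iso_eigenvalues T = upper_semi_Weyl_spectrum T"

end

theory Submission
  imports Defs
begin

text \<open>Since \<open>\<sigma>\<^sub>2(T)\<close> is empty, \<open>\<sigma>(T) = \<sigma>\<^sub>a(T)\<close>, which is closed because being bounded below is
  stable under small perturbations; no Neumann series is needed. A point of the spectrum
  \<open>\<sigma>(T) \<union> \<sigma>(S)\<close> of the sum that is isolated cannot lie in \<open>\<sigma>(T)\<close>, which has no isolated points,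
  and off the closed set \<open>\<sigma>(T)\<close> isolation in the union is isolation in \<open>\<sigma>(S)\<close>. There \<open>T - \<lambda>I\<close>
  is injective, so \<open>E(T \<oplus> S) = E(S) - \<sigma>\<^sub>a(T)\<close>, and the claim is the set identity
  \<open>(A \<union> B) - (E - A) = A \<union> (B - E)\<close>.\<close>

text \<open>The norm comes from the real part of \<open>cinner\<close>. Pulling \<open>a\<close> out
  of both slots produces the factor \<open>a * cnj a\<close>, which is real and so passes through
  \<open>Re\<close>.\<close>

lemma norm_scaleC: "norm (a *\<^sub>C x) = cmod a * norm (x :: 'a::complex_inner)"
proof -
  have "cinner (a *\<^sub>C x) (a *\<^sub>C x) = a * cnj a * cinner x x"
    using cinner_commute[of x "a *\<^sub>C x"] cinner_commute[of x x]
    by (simp add: cinner_scaleC_left)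
  also have "\<dots> = complex_of_real ((cmod a)\<^sup>2) * cinner x x"
    by (simp only: complex_norm_square)
  finally have "(norm (a *\<^sub>C x))\<^sup>2 = (cmod a * norm x)\<^sup>2"
    by (simp add: power2_norm_eq_inner inner_eq_Re_cinner power_mult_distrib)
  then show ?thesis
    by simp
qed

lemma bounded_linear_scaleC_right: "bounded_linear (\<lambda>x :: 'a::complex_inner. a *\<^sub>C x)"
  by (rule bounded_linear_intro[where K = "cmod a"])
     (simp_all add: scaleC_add_right scaleR_eq_scaleC scaleC_scaleC norm_scaleC mult.commute)

lemma bounded_clinear_op_shift:
  assumes "bounded_clinear T"
  shows "bounded_clinear (op_shift T z)"
  using assms
  by (auto simp: bounded_clinear_def op_shift_def cvec.scale_right_diff_distrib scaleC_scaleC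
      mult.commute intro: bounded_linear_sub bounded_linear_scaleC_right)

lemma bounded_clinear_zero: "bounded_clinear T \<Longrightarrow> T 0 = 0"
  by (simp add: bounded_clinear_def linear_simps)

lemma op_shift_op_sum: "op_shift (T \<oplus>\<^sub>o\<^sub>p S) z = op_shift T z \<oplus>\<^sub>o\<^sub>p op_shift S z"
  by (auto simp: op_shift_def op_sum_def scaleC_prod_def)

lemma closed_approx_spectrum: "closed (approx_spectrum T)"
proof -
  have "\<exists>e>0. \<forall>w. dist w z < e \<longrightarrow> bounded_below (op_shift T w)"
    if z: "bounded_below (op_shift T z)" for z
  proof -
    obtain c where c: "c > 0" "\<And>x. c * norm x \<le> norm (op_shift T z x)"
      using z unfolding bounded_below_def by blast
    \<comment> \<open>Moving from \<open>z\<close> to \<open>w\<close> changes the image of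
      \<open>x\<close> by at most \<open>c / 2 * norm x\<close>, so half of the lower bound
      \<open>c\<close> survives.\<close>
    have "bounded_below (op_shift T w)" if w: "dist w z < c / 2" for w
      unfolding bounded_below_def
    proof (intro exI[of _ "c / 2"] conjI allI)
      fix x
      have "op_shift T z x = op_shift T w x + (w - z) *\<^sub>C x"
        by (simp add: op_shift_def cvec.scale_left_diff_distrib)
      then have "norm (op_shift T z x) \<le> norm (op_shift T w x) + cmod (w - z) * norm x"
        by (metis norm_scaleC norm_triangle_ineq)
      moreover have "cmod (w - z) * norm x \<le> c / 2 * norm x"
        using w by (intro mult_right_mono) (auto simp: dist_norm)
      ultimately show "c / 2 * norm x \<le> norm (op_shift T w x)"
        using c(2)[of x] by (simp add: field_simps)
    qed (use c in simp)
    then show ?thesis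
      using c(1) by (intro exI[of _ "c / 2"]) auto
  qed
  then show ?thesis
    by (auto simp: closed_def open_dist approx_spectrum_def)
qed

text \<open>A left inverse \<open>R\<close> with bound \<open>K\<close> gives \<open>norm x = norm
  (R (op_shift T z x)) \<le> K * norm (op_shift T z x)\<close>, hence the lower bound
  \<open>1 / K\<close>.\<close>

lemma approx_spectrum_subset_spectrum: "approx_spectrum T \<subseteq> spectrum T"
proof
  fix z assume z: "z \<in> approx_spectrum T"
  show "z \<in> spectrum T"
  proof (rule ccontr)
    assume "z \<notin> spectrum T"
    then obtain R where "bounded_clinear R" and R: "R \<circ> op_shift T z = id"
      by (auto simp: spectrum_def)
    then obtain K where K: "K > 0" "\<And>y. norm (R y) \<le> norm y * K"
      using bounded_linear.pos_bounded unfolding bounded_clinear_def by blast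
    have "1 / K * norm x \<le> norm (op_shift T z x)" for x
      using K(1) K(2)[of "op_shift T z x"] fun_cong[OF R, of x] by (simp add: field_simps)
    then have "bounded_below (op_shift T z)"
      unfolding bounded_below_def using K(1) by (intro exI[of _ "1 / K"]) auto
    then show False
      using z by (simp add: approx_spectrum_def)
  qed
qed

text \<open>Because both maps fix 0, the vectors \<open>(x, 0)\<close> and \<open>(0, y)\<close>
  test the summands separately. Conversely the smaller of the two constants works for pairs, by
  adding the squared estimates.\<close>

lemma bounded_below_op_sum:
  assumes "A 0 = 0" "B 0 = 0"
  shows "bounded_below (A \<oplus>\<^sub>o\<^sub>p B) \<longleftrightarrow> bounded_below A \<and> bounded_below B"
proof
  assume "bounded_below (A \<oplus>\<^sub>o\<^sub>p B)"
  then obtain c where c: "c > 0" "\<And>p. c * norm p \<le> norm ((A \<oplus>\<^sub>o\<^sub>p B) p)"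
    unfolding bounded_below_def by blast
  have "c * norm x \<le> norm (A x)" "c * norm y \<le> norm (B y)" for x y
    using c(2)[of "(x, 0)"] c(2)[of "(0, y)"] assms by (simp_all add: op_sum_def norm_Pair)
  then show "bounded_below A \<and> bounded_below B"
    unfolding bounded_below_def using c(1) by blast
next
  assume "bounded_below A \<and> bounded_below B"
  then obtain a b where a: "a > 0" "\<And>x. a * norm x \<le> norm (A x)"
    and b: "b > 0" "\<And>y. b * norm y \<le> norm (B y)"
    unfolding bounded_below_def by blast
  define c where "c = min a b"
  have c: "c > 0" "c \<le> a" "c \<le> b"
    using a b by (auto simp: c_def)
  have "c * norm (x, y) \<le> norm (A x, B y)" for x y
  proof -
    have "c * norm x \<le> norm (A x)" "c * norm y \<le> norm (B y)"
      using c a(2)[of x] b(2)[of y] mult_right_mono[of c a "norm x"]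
        mult_right_mono[of c b "norm y"] by auto
    then have "(c * norm x)\<^sup>2 + (c * norm y)\<^sup>2 \<le> (norm (A x))\<^sup>2 + (norm (B y))\<^sup>2"
      using c by (intro add_mono power_mono) auto
    then have "sqrt (c\<^sup>2 * ((norm x)\<^sup>2 + (norm y)\<^sup>2)) \<le> norm (A x, B y)"
      by (simp add: norm_Pair power_mult_distrib distrib_left)
    then show ?thesis
      using c(1) by (simp add: norm_Pair real_sqrt_mult)
  qed
  then show "bounded_below (A \<oplus>\<^sub>o\<^sub>p B)"
    unfolding bounded_below_def op_sum_def using c(1) by auto
qed

lemma approx_spectrum_op_sum:
  assumes "bounded_clinear T" "bounded_clinear S"
  shows "approx_spectrum (T \<oplus>\<^sub>o\<^sub>p S) = approx_spectrum T \<union> approx_spectrum S"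
  using assms
  by (auto simp: approx_spectrum_def op_shift_op_sum bounded_below_op_sum
      bounded_clinear_zero bounded_clinear_op_shift)

lemma bounded_clinear_op_sum:
  assumes "bounded_clinear A" "bounded_clinear B"
  shows "bounded_clinear (A \<oplus>\<^sub>o\<^sub>p B)"
proof -
  have "A \<oplus>\<^sub>o\<^sub>p B = (\<lambda>p. (A (fst p), B (snd p)))"
    by (auto simp: op_sum_def)
  then show ?thesis
    using assms unfolding bounded_clinear_def
    by (auto simp: scaleC_prod_def intro!: bounded_linear_Pair
        intro: bounded_linear_compose bounded_linear_fst bounded_linear_snd)
qed

text \<open>These are the compressions of \<open>R\<close> to the diagonal blocks, the candidates
  for inverses of the summands when \<open>R\<close> inverts a direct sum. \<open>R\<close> itself
  is not assumed to be block diagonal.\<close>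

lemma bounded_clinear_components:
  assumes "bounded_clinear R"
  shows "bounded_clinear (\<lambda>x. fst (R (x, 0)))" "bounded_clinear (\<lambda>y. snd (R (0, y)))"
proof -
  have R: "bounded_linear R" "R (a *\<^sub>C x, a *\<^sub>C y) = a *\<^sub>C R (x, y)" for a x y
    using assms by (auto simp: bounded_clinear_def scaleC_prod_def)
  have "bounded_linear (\<lambda>x. R (x, 0))" "bounded_linear (\<lambda>y. R (0, y))"
    by (rule bounded_linear_compose[OF R(1)];
        intro bounded_linear_Pair bounded_linear_ident bounded_linear_zero)+
  then show "bounded_clinear (\<lambda>x. fst (R (x, 0)))" "bounded_clinear (\<lambda>y. snd (R (0, y)))"
    using R(2)[of _ _ 0] R(2)[of _ 0]
    by (auto simp: bounded_clinear_def scaleC_prod_def bounded_linear_fst_comp bounded_linear_snd_comp)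
qed

lemma spectrum_op_sum:
  assumes T: "bounded_clinear T" and S: "bounded_clinear S"
  shows "spectrum (T \<oplus>\<^sub>o\<^sub>p S) = spectrum T \<union> spectrum S"
proof -
  have "z \<notin> spectrum (T \<oplus>\<^sub>o\<^sub>p S) \<longleftrightarrow> z \<notin> spectrum T \<and> z \<notin> spectrum S" for z
  proof -
    define A B where "A = op_shift T z" and "B = op_shift S z"
    have AB: "A 0 = 0" "B 0 = 0" "op_shift (T \<oplus>\<^sub>o\<^sub>p S) z = A \<oplus>\<^sub>o\<^sub>p B"
      by (simp_all add: A_def B_def op_shift_op_sum bounded_clinear_zero
          bounded_clinear_op_shift T S)
    show ?thesis
    proof
      assume "z \<notin> spectrum (T \<oplus>\<^sub>o\<^sub>p S)"
      then obtain R where R: "bounded_clinear R" "R \<circ> (A \<oplus>\<^sub>o\<^sub>p B) = id" "(A \<oplus>\<^sub>o\<^sub>p B) \<circ> R = id"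
        by (auto simp: spectrum_def AB)
      have left: "R (A x, B y) = (x, y)" for x y
        using fun_cong[OF R(2), of "(x, y)"] by (simp add: op_sum_def)
      have right: "(A (fst (R p)), B (snd (R p))) = p" for p
        using fun_cong[OF R(3), of p] by (simp add: op_sum_def case_prod_beta)
      \<comment> \<open>As \<open>B 0 = 0\<close>, the fact \<open>left\<close> reads
        \<open>R (A x, 0) = (x, 0)\<close>, and symmetrically for \<open>B\<close>. The right
        inverses below are single coordinates of \<open>right\<close>.\<close>
      have "(\<lambda>x. fst (R (x, 0))) \<circ> A = id" "(\<lambda>y. snd (R (0, y))) \<circ> B = id"
        using left[of _ 0] left[of 0] AB by (auto simp: fun_eq_iff)
      moreover have "A \<circ> (\<lambda>x. fst (R (x, 0))) = id" "B \<circ> (\<lambda>y. snd (R (0, y))) = id"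
        using right by (auto simp: fun_eq_iff prod_eq_iff)
      ultimately show "z \<notin> spectrum T \<and> z \<notin> spectrum S"
        using bounded_clinear_components[OF R(1)] unfolding spectrum_def A_def B_def by blast
    next
      assume "z \<notin> spectrum T \<and> z \<notin> spectrum S"
      then obtain P Q where "bounded_clinear P" "P \<circ> A = id" "A \<circ> P = id"
        "bounded_clinear Q" "Q \<circ> B = id" "B \<circ> Q = id"
        by (auto simp: spectrum_def A_def B_def)
      then have "bounded_clinear (P \<oplus>\<^sub>o\<^sub>p Q)" "(P \<oplus>\<^sub>o\<^sub>p Q) \<circ> (A \<oplus>\<^sub>o\<^sub>p B) = id"
        "(A \<oplus>\<^sub>o\<^sub>p B) \<circ> (P \<oplus>\<^sub>o\<^sub>p Q) = id"
        using bounded_clinear_op_sum[of P Q] by (auto simp: op_sum_def fun_eq_iff)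
      then have "\<exists>R. bounded_clinear R \<and> R \<circ> (A \<oplus>\<^sub>o\<^sub>p B) = id \<and> (A \<oplus>\<^sub>o\<^sub>p B) \<circ> R = id"
        by blast
      then show "z \<notin> spectrum (T \<oplus>\<^sub>o\<^sub>p S)"
        by (simp add: spectrum_def AB conj_ac)
    qed
  qed
  then show ?thesis
    by blast
qed

text \<open>The value 0 of \<open>edim\<close> differs from \<infinity>, so it provides a finite
  spanning set and excludes the case where \<open>cdim\<close> is 0 merely by convention.\<close>

lemma nullity_pos_iff: "nullity A > 0 \<longleftrightarrow> (\<exists>x. x \<noteq> 0 \<and> A x = 0)"
proof -
  have "nullity A = 0 \<longleftrightarrow> {x. A x = 0} \<subseteq> {0}"
  proof
    assume "nullity A = 0"
    then obtain F where F: "finite F" "{x. A x = 0} \<subseteq> cspan F" "cdim {x. A x = 0} = 0"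
      by (auto simp: nullity_def edim_def zero_enat_def split: if_splits)
    obtain B where B: "B \<subseteq> {x. A x = 0}" "cindependent B" "{x. A x = 0} \<subseteq> cspan B"
      "card B = cdim {x. A x = 0}"
      using cvec.basis_exists by blast
    \<comment> \<open>Only for finite \<open>B\<close> does \<open>card B = 0\<close> force
      \<open>B = {}\<close>, since \<open>card\<close> is also 0 on infinite sets.\<close>
    have "finite B"
      using cvec.independent_span_bound[OF F(1) B(2)] B(1) F(2) by blast
    then show "{x. A x = 0} \<subseteq> {0}"
      using B(3,4) F(3) by simp
  next
    assume sub: "{x. A x = 0} \<subseteq> {0}"
    then have "cdim {x. A x = 0} \<le> card ({} :: 'a set)"
      by (intro cvec.dim_le_card) auto
    then show "nullity A = 0"
      using sub unfolding nullity_def edim_def zero_enat_def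
      by (auto intro!: exI[of _ "{}"])
  qed
  then show ?thesis
    by auto
qed

lemma injective_off_spectrum:
  assumes "bounded_clinear T" "z \<notin> spectrum T" "op_shift T z x = 0"
  shows "x = 0"
proof -
  obtain R where "R \<circ> op_shift T z = id"
    using assms(2) by (auto simp: spectrum_def)
  then have "inj (op_shift T z)"
    by (metis inj_on_id inj_on_imageI2)
  then show ?thesis
    using assms bounded_clinear_zero[OF bounded_clinear_op_shift[OF assms(1)]]
    by (metis injD)
qed

text \<open>If \<open>U\<close> isolates \<open>z\<close> in \<open>B\<close>, the open set
  \<open>U - A\<close> still contains \<open>z\<close> and meets the union in \<open>z\<close>
  alone. Conversely, a neighbourhood isolating \<open>z\<close> in the union also does so in
  \<open>B\<close>, where \<open>z\<close> must lie.\<close>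

lemma isolated_in_Un_closed:
  assumes "closed A" "z \<notin> A"
  shows "z isolated_in (A \<union> B) \<longleftrightarrow> z isolated_in B"
proof
  assume "z isolated_in B"
  then obtain U where U: "open U" "U \<inter> B = {z}"
    by (auto simp: isolated_in_def)
  then have "open (U - A)" "(U - A) \<inter> (A \<union> B) = {z}"
    using assms by (auto intro: open_Diff)
  then show "z isolated_in (A \<union> B)"
    unfolding isolated_in_def by blast
next
  assume "z isolated_in (A \<union> B)"
  then show "z isolated_in B"
    using assms(2) unfolding isolated_in_def by blast
qed

lemma iso_eigenvalues_op_sum:
  assumes T: "bounded_clinear T" and S: "bounded_clinear S"
    and iso: "iso_spectrum T = {}" and closed: "closed (spectrum T)"
  shows "iso_eigenvalues (T \<oplus>\<^sub>o\<^sub>p S) = iso_eigenvalues S - spectrum T"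
proof -
  have "z \<in> iso_eigenvalues (T \<oplus>\<^sub>o\<^sub>p S) \<longleftrightarrow> z \<in> iso_eigenvalues S \<and> z \<notin> spectrum T" for z
  proof (cases "z \<in> spectrum T")
    case True
    \<comment> \<open>Isolation passes to any subset containing the point, so \<open>z\<close> would
      be isolated in \<open>spectrum T\<close>, contradicting \<open>iso\<close>.\<close>
    then show ?thesis
      using iso isolated_in_subset[of z "spectrum T \<union> spectrum S" "spectrum T"]
      by (auto simp: iso_eigenvalues_def iso_spectrum_def spectrum_op_sum[OF T S])
  next
    case False
    have "op_shift T z x = 0 \<longleftrightarrow> x = 0" for x
      using injective_off_spectrum[OF T False, of x]
        bounded_clinear_zero[OF bounded_clinear_op_shift[OF T]] by blast
    moreover have "op_shift (T \<oplus>\<^sub>o\<^sub>p S) z (x, y) = (op_shift T z x, op_shift S z y)" for x y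
      unfolding op_shift_op_sum by (simp add: op_sum_def)
    \<comment> \<open>The kernel vectors of the shifted sum are exactly the pairs
      \<open>(0, y)\<close> with \<open>y\<close> in the kernel of
      \<open>op_shift S z\<close>.\<close>
    ultimately have "nullity (op_shift (T \<oplus>\<^sub>o\<^sub>p S) z) > 0 \<longleftrightarrow> nullity (op_shift S z) > 0"
      unfolding nullity_pos_iff by (auto simp: zero_prod_def)
    then show ?thesis
      using False isolated_in_Un_closed[OF closed False]
      by (simp add: iso_eigenvalues_def iso_spectrum_def spectrum_op_sum[OF T S])
  qed
  then show ?thesis
    by blast
qed

theorem theorem3p4:
  fixes T :: "'h::complex_hilbert_space \<Rightarrow> 'h"
    and S :: "'k::complex_hilbert_space \<Rightarrow> 'k"
  assumes "separable_space (euclidean :: 'h topology)"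
    and "edim (UNIV :: 'h set) = \<infinity>"
    and "separable_space (euclidean :: 'k topology)"
    and "edim (UNIV :: 'k set) = \<infinity>"
    and "bounded_clinear T" and "bounded_clinear S"
    and "iso_spectrum T = {}"
    and "property_UWE S"
    and "upper_semi_Weyl_spectrum (T \<oplus>\<^sub>o\<^sub>p S) = approx_spectrum T \<union> upper_semi_Weyl_spectrum S"
    and "sigma2 T = {}"
  shows "property_UWE (T \<oplus>\<^sub>o\<^sub>p S)"
proof -
  have "spectrum T = approx_spectrum T"
    using assms(10) approx_spectrum_subset_spectrum[of T] by (auto simp: sigma2_def)
  then have "iso_eigenvalues (T \<oplus>\<^sub>o\<^sub>p S) = iso_eigenvalues S - approx_spectrum T"
    using iso_eigenvalues_op_sum[OF assms(5,6,7)] closed_approx_spectrum[of T] by simp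
  \<comment> \<open>The set identity is used with \<open>approx_spectrum T\<close>,
    \<open>approx_spectrum S\<close> and \<open>iso_eigenvalues S\<close> as A, B and E;
    \<open>property_UWE S\<close> identifies B - E with
    \<open>upper_semi_Weyl_spectrum S\<close>.\<close>
  then show ?thesis
    using assms(8,9) approx_spectrum_op_sum[OF assms(5,6)]
    unfolding property_UWE_def by auto
qed

end
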